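(* Let a concurrent program, an initial state $s_0$ and a safety property $\psi$ be given (setting described in the context). Consider the selective depth-first search algorithm that calls $\mathsf{Explore}(s_0)$, where $\mathsf{Explore}(s)$ is defined as follows: (1) if $s \not\models \psi$, report an error and terminate the whole search; (2) let $T := \mathsf{Persistent\_Set}(s)$; (3) for each transition $t \in T$ that is enabled at $s$, compute the successor $s \xrightarrow{t} s'$ and call $\mathsf{Explore}(s')$. This algorithm is sound: if it finishes without reporting an error, then the program is safe with respect to $\psi$, i.e. every state reachable from $s_0$ satisfies $\psi$.
   Context: A concurrent program consists of finitely many processes $P_1,\dots,P_n$. Each $P_i$ has a finite set $trans_i$ of transitions whose control-flow graph is acyclic; the sets $trans_i$ are pairwise disjoint, and $\mathcal{T}=\bigcup_i trans_i$. Variables are shared variables plus local variables of each process, including a program counter $pc_i$. A (symbolic) state $s$ consists of a global program point $\mathtt{pc}(s)=\langle pc_1,\dots,pc_n\rangle$ and a first-order constraint $[\![s]\!]$ over the program variables; $s\models\varphi$ means $[\![s]\!]$ implies $\varphi$. A state is infeasible if $[\![s]\!]$ is unsatisfiable; an infeasible state satisfies every formula. A transition $t$ of $P_i$ moves $P_i$ from local location $\ell_1$ to $\ell_2$, is guarded by a condition $\mathit{cond}$ and has an effect on the variables; $t$ is schedulable at $s$ if $\mathtt{pc}(s)[i]=\ell_1$, and enabled at $s$ if moreover $s\models \mathit{cond}$. Executing a schedulable transition $t$ from $s$ yields a state $s'$ (written $s\xrightarrow{t}s'$); if $t$ is schedulable but not enabled, $s'$ is infeasible. A state with no schedulable transitions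 is terminal. For $\theta\in\mathcal{T}^*$, $s\stackrel{\theta}{\Longrightarrow}s'$ denotes a sequence of such steps (a derivation), and $s'$ is then reachable from $s$. An (execution) trace is a sequence $\rho$ with $s_0\stackrel{\rho}{\Longrightarrow}s_f$, $s_f$ terminal. A trace $\rho$ is safe wrt $\psi$, written $\rho\models\psi$, if all its states satisfy $\psi$. For $t_1,t_2\in\mathcal{T}$, $t_1$ can de-schedule $t_2$ iff there is a state at which both are schedulable but $t_2$ is not schedulable after executing $t_1$. Trace coverage: $\rho_1\sqsupseteq_\psi\rho_2$ iff $\rho_1\models\psi$ implies $\rho_2\models\psi$. Semi-commutativity after a state: given a derivation $s_0\stackrel{\theta}{\Longrightarrow}s$ and $t_1,t_2\in\mathcal{T}$ that cannot de-schedule each other, $t_1$ semi-commutes with $t_2$ after $s$ wrt $\sqsupseteq_\psi$ iff for all $w_1,w_2\in\mathcal{T}^*$ such that $\theta w_1 t_1 t_2 w_2$ and $\theta w_1 t_2 t_1 w_2$ are execution traces, $\theta w_1 t_1 t_2 w_2\sqsupseteq_\psi \theta w_1 t_2 t_1 w_2$. Persistent set of a state: a set $T\subseteq\mathcal{T}$ of transitions schedulable at $s$ is persistent in $s$ wrt $\psi$ iff for every derivation $s\xrightarrow{t_1}s_1\xrightarrow{t_2}\cdots\xrightarrow{t_m}s_m$ with all $t_i\in\mathcal{T}\setminus T$, every transition of $T$ semi-commutes with every $t_i$ after $s$ wrt $\sqsupseteq_\psi$. $\mathsf{Persistent\_Set}(s)$ returns a set persistent in $s$ wrt $\psi$ (with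 respect to the derivation by which the search reached $s$) which, as in the paper's construction, contains a transition enabled at $s$ if one exists. *)

theory Defs
  imports Main
begin

datatype ('p, 'g, 'v) var = Shared 'g | Local 'p 'v

type_synonym ('p, 'g, 'v, 'd) store = "('p, 'g, 'v) var \<Rightarrow> 'd"

text \<open>Formulas are represented by their semantics. The program counters are program variables
  too; they are kept apart from the data variables because their values are locations, so a
  formula is a predicate on a vector of program counters together with a store.\<close>

type_synonym ('p, 'l, 'g, 'v, 'd) form = "('p \<Rightarrow> 'l) \<Rightarrow> ('p, 'g, 'v, 'd) store \<Rightarrow> bool"

text \<open>The processes are the elements of the type \<open>'p\<close>, which will be finite. Transitions are
  names of type \<open>'t\<close>. The effect of a transition on the data variables is a relation on stores, so
  assignments and nondeterministic updates are both covered.\<close>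

record ('p, 'l, 'g, 'v, 'd, 't) program =
  trans_of :: "'p \<Rightarrow> 't set"
  src :: "'t \<Rightarrow> 'l"
  tgt :: "'t \<Rightarrow> 'l"
  cond :: "'t \<Rightarrow> ('p, 'l, 'g, 'v, 'd) form"
  effect :: "'t \<Rightarrow> ('p, 'g, 'v, 'd) store rel"

definition transitions :: "('p, 'l, 'g, 'v, 'd, 't) program \<Rightarrow> 't set" where
  "transitions P = (\<Union>i. trans_of P i)"

definition visible :: "'p \<Rightarrow> ('p, 'g, 'v) var set" where
  "visible i = range Shared \<union> range (Local i)"

definition local_form :: "'p \<Rightarrow> ('p, 'l, 'g, 'v, 'd) form \<Rightarrow> bool" where
  "local_form i \<phi> \<longleftrightarrow>
     (\<forall>\<pi> \<pi>' \<sigma> \<sigma>'. \<pi> i = \<pi>' i \<and> (\<forall>x\<in>visible i. \<sigma> x = \<sigma>' x) \<longrightarrow> \<phi> \<pi> \<sigma> = \<phi> \<pi>' \<sigma>')"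

text \<open>The effect leaves the local variables of the other processes unchanged and does not depend
  on them.\<close>

definition local_effect :: "'p \<Rightarrow> ('p, 'g, 'v, 'd) store rel \<Rightarrow> bool" where
  "local_effect i R \<longleftrightarrow>
     (\<forall>\<sigma> \<sigma>'. (\<sigma>, \<sigma>') \<in> R \<longrightarrow>
        (\<forall>x. x \<notin> visible i \<longrightarrow> \<sigma>' x = \<sigma> x) \<and>
        (\<forall>\<tau>. (\<forall>x\<in>visible i. \<tau> x = \<sigma> x) \<longrightarrow>
             (\<tau>, \<lambda>x. if x \<in> visible i then \<sigma>' x else \<tau> x) \<in> R))"

definition concurrent_program :: "('p::finite, 'l, 'g, 'v, 'd, 't) program \<Rightarrow> bool" where
  "concurrent_program P \<longleftrightarrow>
     (\<forall>i. finite (trans_of P i)) \<and>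
     (\<forall>i j. i \<noteq> j \<longrightarrow> trans_of P i \<inter> trans_of P j = {}) \<and>
     (\<forall>i. acyclic {(src P t, tgt P t) | t. t \<in> trans_of P i}) \<and>
     (\<forall>i. \<forall>t\<in>trans_of P i. local_form i (cond P t) \<and> local_effect i (effect P t))"

text \<open>The constraint of a symbolic state is the set of stores satisfying it, the program counters
  having the values given by the program point.\<close>

record ('p, 'l, 'g, 'v, 'd) state =
  pc :: "'p \<Rightarrow> 'l"
  constr :: "('p, 'g, 'v, 'd) store set"

definition satisfies ::
    "('p, 'l, 'g, 'v, 'd) state \<Rightarrow> ('p, 'l, 'g, 'v, 'd) form \<Rightarrow> bool" where
  "satisfies s \<phi> \<longleftrightarrow> (\<forall>\<sigma>\<in>constr s. \<phi> (pc s) \<sigma>)"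

definition schedulable ::
    "('p, 'l, 'g, 'v, 'd, 't) program \<Rightarrow> ('p, 'l, 'g, 'v, 'd) state \<Rightarrow> 't \<Rightarrow> bool" where
  "schedulable P s t \<longleftrightarrow> (\<exists>i. t \<in> trans_of P i \<and> pc s i = src P t)"

definition enabled ::
    "('p, 'l, 'g, 'v, 'd, 't) program \<Rightarrow> ('p, 'l, 'g, 'v, 'd) state \<Rightarrow> 't \<Rightarrow> bool" where
  "enabled P s t \<longleftrightarrow> schedulable P s t \<and> satisfies s (cond P t)"

text \<open>An enabled transition yields the strongest postcondition of the constraint under the effect;
  a schedulable transition that is not enabled moves the program counter but yields the
  unsatisfiable constraint.\<close>

definition step ::
    "('p, 'l, 'g, 'v, 'd, 't) program \<Rightarrow> ('p, 'l, 'g, 'v, 'd) state \<Rightarrow> 't \<Rightarrow>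
     ('p, 'l, 'g, 'v, 'd) state \<Rightarrow> bool" where
  "step P s t s' \<longleftrightarrow>
     (\<exists>i. t \<in> trans_of P i \<and> pc s i = src P t \<and>
          s' = \<lparr>pc = (pc s)(i := tgt P t),
                constr = (if enabled P s t then effect P t `` constr s else {})\<rparr>)"

definition terminal ::
    "('p, 'l, 'g, 'v, 'd, 't) program \<Rightarrow> ('p, 'l, 'g, 'v, 'd) state \<Rightarrow> bool" where
  "terminal P s \<longleftrightarrow> \<not> (\<exists>t. schedulable P s t)"

inductive derivation ::
    "('p, 'l, 'g, 'v, 'd, 't) program \<Rightarrow> ('p, 'l, 'g, 'v, 'd) state \<Rightarrow> 't list \<Rightarrow>
     ('p, 'l, 'g, 'v, 'd) state \<Rightarrow> bool"
  for P where
  derivation_Nil: "derivation P s [] s"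
| derivation_Cons: "step P s t s' \<Longrightarrow> derivation P s' \<theta> s'' \<Longrightarrow> derivation P s (t # \<theta>) s''"

definition reachable ::
    "('p, 'l, 'g, 'v, 'd, 't) program \<Rightarrow> ('p, 'l, 'g, 'v, 'd) state \<Rightarrow>
     ('p, 'l, 'g, 'v, 'd) state \<Rightarrow> bool" where
  "reachable P s s' \<longleftrightarrow> (\<exists>\<theta>. derivation P s \<theta> s')"

definition exec_trace ::
    "('p, 'l, 'g, 'v, 'd, 't) program \<Rightarrow> ('p, 'l, 'g, 'v, 'd) state \<Rightarrow> 't list \<Rightarrow> bool" where
  "exec_trace P s0 \<rho> \<longleftrightarrow> (\<exists>s. derivation P s0 \<rho> s \<and> terminal P s)"

text \<open>The states of a trace are those reached by its prefixes.\<close>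

definition trace_safe ::
    "('p, 'l, 'g, 'v, 'd, 't) program \<Rightarrow> ('p, 'l, 'g, 'v, 'd) state \<Rightarrow>
     ('p, 'l, 'g, 'v, 'd) form \<Rightarrow> 't list \<Rightarrow> bool" where
  "trace_safe P s0 \<psi> \<rho> \<longleftrightarrow> (\<forall>\<theta> w s. \<rho> = \<theta> @ w \<and> derivation P s0 \<theta> s \<longrightarrow> satisfies s \<psi>)"

definition covers ::
    "('p, 'l, 'g, 'v, 'd, 't) program \<Rightarrow> ('p, 'l, 'g, 'v, 'd) state \<Rightarrow>
     ('p, 'l, 'g, 'v, 'd) form \<Rightarrow> 't list \<Rightarrow> 't list \<Rightarrow> bool" where
  "covers P s0 \<psi> \<rho>1 \<rho>2 \<longleftrightarrow> (trace_safe P s0 \<psi> \<rho>1 \<longrightarrow> trace_safe P s0 \<psi> \<rho>2)"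

definition can_deschedule :: "('p, 'l, 'g, 'v, 'd, 't) program \<Rightarrow> 't \<Rightarrow> 't \<Rightarrow> bool" where
  "can_deschedule P t1 t2 \<longleftrightarrow>
     (\<exists>s s'. schedulable P s t1 \<and> schedulable P s t2 \<and> step P s t1 s' \<and> \<not> schedulable P s' t2)"

text \<open>Semi-commutativity is only meaningful after a derivation and for transitions that cannot
  de-schedule each other; otherwise it is taken to fail.\<close>

definition semi_commutes_after ::
    "('p, 'l, 'g, 'v, 'd, 't) program \<Rightarrow> ('p, 'l, 'g, 'v, 'd) state \<Rightarrow>
     ('p, 'l, 'g, 'v, 'd) form \<Rightarrow> 't list \<Rightarrow> ('p, 'l, 'g, 'v, 'd) state \<Rightarrow> 't \<Rightarrow> 't \<Rightarrow> bool" where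
  "semi_commutes_after P s0 \<psi> \<theta> s t1 t2 \<longleftrightarrow>
     derivation P s0 \<theta> s \<and> t1 \<in> transitions P \<and> t2 \<in> transitions P \<and>
     \<not> can_deschedule P t1 t2 \<and> \<not> can_deschedule P t2 t1 \<and>
     (\<forall>w1 w2. set w1 \<subseteq> transitions P \<and> set w2 \<subseteq> transitions P \<and>
        exec_trace P s0 (\<theta> @ w1 @ [t1, t2] @ w2) \<and> exec_trace P s0 (\<theta> @ w1 @ [t2, t1] @ w2) \<longrightarrow>
        covers P s0 \<psi> (\<theta> @ w1 @ [t1, t2] @ w2) (\<theta> @ w1 @ [t2, t1] @ w2))"

definition persistent ::
    "('p, 'l, 'g, 'v, 'd, 't) program \<Rightarrow> ('p, 'l, 'g, 'v, 'd) state \<Rightarrow>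
     ('p, 'l, 'g, 'v, 'd) form \<Rightarrow> 't list \<Rightarrow> ('p, 'l, 'g, 'v, 'd) state \<Rightarrow> 't set \<Rightarrow> bool" where
  "persistent P s0 \<psi> \<theta> s T \<longleftrightarrow>
     T \<subseteq> {t. schedulable P s t} \<and>
     (\<forall>ts s'. derivation P s ts s' \<and> set ts \<subseteq> transitions P - T \<longrightarrow>
        (\<forall>t\<in>T. \<forall>u\<in>set ts. semi_commutes_after P s0 \<psi> \<theta> s t u))"

text \<open>\<open>PS \<theta> s\<close> is the set returned by the call of the persistent-set procedure at \<open>s\<close> when the search has
  reached \<open>s\<close> by the derivation \<open>\<theta>\<close>. The derivation is only bookkeeping for the search itself.\<close>

datatype outcome = Finished | Error

text \<open>\<open>explore P \<psi> PS \<theta> s r\<close>: the call Explore(s) ends with outcome \<open>r\<close>, where \<open>Error\<close> aborts the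
  whole search. \<open>explore_each\<close> is the loop over the persistent set, whose elements may be listed
  in any order.\<close>

inductive
  explore ::
    "('p, 'l, 'g, 'v, 'd, 't) program \<Rightarrow> ('p, 'l, 'g, 'v, 'd) form \<Rightarrow>
     ('t list \<Rightarrow> ('p, 'l, 'g, 'v, 'd) state \<Rightarrow> 't set) \<Rightarrow>
     't list \<Rightarrow> ('p, 'l, 'g, 'v, 'd) state \<Rightarrow> outcome \<Rightarrow> bool" and
  explore_each ::
    "('p, 'l, 'g, 'v, 'd, 't) program \<Rightarrow> ('p, 'l, 'g, 'v, 'd) form \<Rightarrow>
     ('t list \<Rightarrow> ('p, 'l, 'g, 'v, 'd) state \<Rightarrow> 't set) \<Rightarrow>
     't list \<Rightarrow> ('p, 'l, 'g, 'v, 'd) state \<Rightarrow> 't list \<Rightarrow> outcome \<Rightarrow> bool"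
  for P \<psi> PS where
  explore_error: "\<not> satisfies s \<psi> \<Longrightarrow> explore P \<psi> PS \<theta> s Error"
| explore_loop: "satisfies s \<psi> \<Longrightarrow> set ts = PS \<theta> s \<Longrightarrow> distinct ts \<Longrightarrow>
    explore_each P \<psi> PS \<theta> s ts r \<Longrightarrow> explore P \<psi> PS \<theta> s r"
| each_done: "explore_each P \<psi> PS \<theta> s [] Finished"
| each_disabled: "\<not> enabled P s t \<Longrightarrow> explore_each P \<psi> PS \<theta> s ts r \<Longrightarrow>
    explore_each P \<psi> PS \<theta> s (t # ts) r"
| each_error: "enabled P s t \<Longrightarrow> step P s t s' \<Longrightarrow> explore P \<psi> PS (\<theta> @ [t]) s' Error \<Longrightarrow>
    explore_each P \<psi> PS \<theta> s (t # ts) Error"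
| each_next: "enabled P s t \<Longrightarrow> step P s t s' \<Longrightarrow> explore P \<psi> PS (\<theta> @ [t]) s' Finished \<Longrightarrow>
    explore_each P \<psi> PS \<theta> s ts r \<Longrightarrow> explore_each P \<psi> PS \<theta> s (t # ts) r"

text \<open>The derivations along which the search may make a call of Explore, started at \<open>s0\<close>.\<close>

inductive search_reaches ::
    "('p, 'l, 'g, 'v, 'd, 't) program \<Rightarrow> ('p, 'l, 'g, 'v, 'd) state \<Rightarrow>
     ('p, 'l, 'g, 'v, 'd) form \<Rightarrow>
     ('t list \<Rightarrow> ('p, 'l, 'g, 'v, 'd) state \<Rightarrow> 't set) \<Rightarrow>
     't list \<Rightarrow> ('p, 'l, 'g, 'v, 'd) state \<Rightarrow> bool"
  for P s0 \<psi> PS where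
  search_init: "search_reaches P s0 \<psi> PS [] s0"
| search_succ: "search_reaches P s0 \<psi> PS \<theta> s \<Longrightarrow> satisfies s \<psi> \<Longrightarrow> t \<in> PS \<theta> s \<Longrightarrow>
    enabled P s t \<Longrightarrow> step P s t s' \<Longrightarrow> search_reaches P s0 \<psi> PS (\<theta> @ [t]) s'"

definition persistent_set_procedure ::
    "('p, 'l, 'g, 'v, 'd, 't) program \<Rightarrow> ('p, 'l, 'g, 'v, 'd) state \<Rightarrow>
     ('p, 'l, 'g, 'v, 'd) form \<Rightarrow>
     ('t list \<Rightarrow> ('p, 'l, 'g, 'v, 'd) state \<Rightarrow> 't set) \<Rightarrow> bool" where
  "persistent_set_procedure P s0 \<psi> PS \<longleftrightarrow>
     (\<forall>\<theta> s. search_reaches P s0 \<psi> PS \<theta> s \<longrightarrow>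
        persistent P s0 \<psi> \<theta> s (PS \<theta> s) \<and>
        ((\<exists>t. enabled P s t) \<longrightarrow> (\<exists>t\<in>PS \<theta> s. enabled P s t)))"

end

(* A search that finishes without error has explored, from each state it visits, every enabled
   transition of the persistent set. Given an execution trace that continues a visited state,
   take the first of its transitions t that lies in the persistent set; it exists because no
   transition outside the set can de-schedule a member of the set, so otherwise the trace would
   not be maximal. By semi-commutativity, t can be moved to the front and safety of the new trace
   implies safety of the old one. The new trace starts with an explored transition, whose
   remainder is shorter, or with a disabled one, after which all states are infeasible. So by
   induction all traces are safe, and acyclicity extends every derivation to a trace. *)

theory Submission imports Defs begin

section \<open>Steps and derivations: determinism, and control flow independent of data\<close>

lemma process_unique:
  assumes "concurrent_program P" "t \<in> trans_of P i" "t \<in> trans_of P j"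
  shows "i = j"
  using assms unfolding concurrent_program_def by blast

lemma src_neq_tgt:
  assumes "concurrent_program P" "t \<in> trans_of P i"
  shows "src P t \<noteq> tgt P t"
proof
  assume "src P t = tgt P t"
  then have "(src P t, src P t) \<in> {(src P t, tgt P t) | t. t \<in> trans_of P i}"
    using assms(2) by force
  moreover have "acyclic {(src P t, tgt P t) | t. t \<in> trans_of P i}"
    using assms(1) by (simp add: concurrent_program_def)
  ultimately show False unfolding acyclic_def by blast
qed

lemma schedulable_iff:
  assumes "concurrent_program P" "t \<in> trans_of P i"
  shows "schedulable P s t \<longleftrightarrow> pc s i = src P t"
  unfolding schedulable_def using assms(2) process_unique[OF assms] by metis

lemma terminal_cong: "pc s = pc s' \<Longrightarrow> terminal P s = terminal P s'"
  by (simp add: terminal_def schedulable_def)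

lemma step_iff:
  assumes "concurrent_program P" "t \<in> trans_of P i"
  shows "step P s t s' \<longleftrightarrow> pc s i = src P t \<and>
    s' = \<lparr>pc = (pc s)(i := tgt P t),
          constr = (if enabled P s t then effect P t `` constr s else {})\<rparr>"
  unfolding step_def using assms(2) process_unique[OF assms] by metis

lemma step_schedulable: "step P s t s' \<Longrightarrow> schedulable P s t"
  by (auto simp: step_def schedulable_def)

lemma schedulable_step: "schedulable P s t \<Longrightarrow> \<exists>s'. step P s t s'"
  by (auto simp: step_def schedulable_def)

lemma step_in_transitions: "step P s t s' \<Longrightarrow> t \<in> transitions P"
  by (auto simp: step_def transitions_def)

lemma step_deterministic:
  assumes "concurrent_program P" "step P s t s1" "step P s t s2"
  shows "s1 = s2"
proof -
  obtain i where "t \<in> trans_of P i" using assms(2) by (auto simp: step_def)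
  then show ?thesis using assms(2,3) by (simp add: step_iff[OF assms(1)])
qed

text \<open>Scheduling looks only at program counters: a failed guard empties the constraint but
  does not block the step.\<close>

lemma step_pc_cong:
  assumes "step P s t s'" "pc s = pc r"
  shows "\<exists>r'. step P r t r' \<and> pc r' = pc s'"
  using assms by (auto simp: step_def)

lemma derivation_Cons_iff:
  "derivation P s (t # \<theta>) s'' \<longleftrightarrow> (\<exists>s'. step P s t s' \<and> derivation P s' \<theta> s'')"
  by (subst derivation.simps) auto

lemma derivation_Nil_iff: "derivation P s [] s' \<longleftrightarrow> s' = s"
  by (subst derivation.simps) auto

lemma derivation_append_iff:
  "derivation P s (\<theta> @ w) s'' \<longleftrightarrow> (\<exists>s'. derivation P s \<theta> s' \<and> derivation P s' w s'')"
  by (induction \<theta> arbitrary: s) (auto simp: derivation_Nil_iff derivation_Cons_iff)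

lemma derivation_in_transitions: "derivation P s \<theta> s' \<Longrightarrow> set \<theta> \<subseteq> transitions P"
  by (induction rule: derivation.induct) (auto dest: step_in_transitions)

lemma derivation_deterministic:
  assumes P: "concurrent_program P"
  shows "derivation P s \<theta> s1 \<Longrightarrow> derivation P s \<theta> s2 \<Longrightarrow> s1 = s2"
proof (induction rule: derivation.induct)
  case (derivation_Cons s t s' \<theta> s1)
  obtain s'' where s'': "step P s t s''" "derivation P s'' \<theta> s2"
    using derivation_Cons.prems unfolding derivation_Cons_iff by blast
  show ?case
    using derivation_Cons.IH s''(2)
    unfolding step_deterministic[OF P derivation_Cons.hyps(1) s''(1)] .
qed (simp add: derivation_Nil_iff)

text \<open>Lets the suffix of a trace be replayed from another state at the same program point,
  whatever its constraint.\<close>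

lemma derivation_pc_cong:
  "derivation P s \<theta> s' \<Longrightarrow> pc s = pc r \<Longrightarrow> \<exists>r'. derivation P r \<theta> r' \<and> pc r' = pc s'"
proof (induction arbitrary: r rule: derivation.induct)
  case (derivation_Cons s t s' \<theta> s'')
  obtain r1 where "step P r t r1" "pc r1 = pc s'"
    using step_pc_cong[OF derivation_Cons.hyps(1) derivation_Cons.prems] by blast
  moreover from this obtain r2 where "derivation P r1 \<theta> r2" "pc r2 = pc s''"
    using derivation_Cons.IH[of r1] by auto
  ultimately show ?case unfolding derivation_Cons_iff by blast
qed (auto simp: derivation_Nil_iff)

section \<open>Propagation of infeasibility\<close>

lemma infeasible_step: "step P s t s' \<Longrightarrow> constr s = {} \<Longrightarrow> constr s' = {}"
  by (auto simp: step_def split: if_splits)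

lemma infeasible_derivation: "derivation P s \<theta> s' \<Longrightarrow> constr s = {} \<Longrightarrow> constr s' = {}"
  by (induction rule: derivation.induct) (auto dest: infeasible_step)

lemma disabled_step_infeasible: "step P s t s' \<Longrightarrow> \<not> enabled P s t \<Longrightarrow> constr s' = {}"
  by (auto simp: step_def)

section \<open>Reordering transitions within traces\<close>

lemma step_swap:
  assumes P: "concurrent_program P"
    and u: "step P s u s1" and t: "step P s1 t s2" and sched: "schedulable P s t"
    and nd: "\<not> can_deschedule P t u"
  shows "\<exists>r1 r2. step P s t r1 \<and> step P r1 u r2 \<and> pc r2 = pc s2"
proof -
  obtain i where i: "u \<in> trans_of P i" using u by (auto simp: step_def)
  obtain j where j: "t \<in> trans_of P j" using t by (auto simp: step_def)
  obtain r1 where r1: "step P s t r1" using schedulable_step[OF sched] by blast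
  then have "schedulable P r1 u"
    using nd sched step_schedulable[OF u] unfolding can_deschedule_def by blast
  then obtain r2 where r2: "step P r1 u r2" using schedulable_step[of P r1 u] by blast
  have pcs: "pc s1 = (pc s)(i := tgt P u)" "pc s2 = (pc s1)(j := tgt P t)"
      "pc r1 = (pc s)(j := tgt P t)" "pc r2 = (pc r1)(i := tgt P u)"
    using u t r1 r2 step_iff[OF P i] step_iff[OF P j] by simp_all
  have "pc s i = src P u" "pc s1 j = src P t" "pc s j = src P t"
    using step_schedulable[OF u] step_schedulable[OF t] sched
    by (simp_all add: schedulable_iff[OF P i] schedulable_iff[OF P j])
  \<comment> \<open>If \<open>i = j\<close>, both transitions start at \<open>pc s i\<close>, and
    \<open>tgt P u\<close> equals \<open>src P t\<close> as well, so \<open>u\<close> would be a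
    self-loop. In distinct processes the two counter updates commute.\<close>
  then have "i \<noteq> j" using pcs(1) src_neq_tgt[OF P i] by auto
  then have "pc r2 = pc s2" using pcs by (simp add: fun_upd_twist)
  then show ?thesis using r1 r2 by blast
qed

lemma schedulable_persists:
  assumes "derivation P s us s'" "schedulable P s t" "\<forall>u\<in>set us. \<not> can_deschedule P u t"
  shows "schedulable P s' t"
  using assms
proof (induction rule: derivation.induct)
  case (derivation_Cons s u s' us s'')
  have "\<not> can_deschedule P u t" using derivation_Cons.prems(2) by simp
  then have "schedulable P s' t"
    using derivation_Cons.hyps(1) derivation_Cons.prems(1) step_schedulable[OF derivation_Cons.hyps(1)]
    unfolding can_deschedule_def by blast
  then show ?case using derivation_Cons.IH derivation_Cons.prems(2) by simp
qed

text \<open>Replaying \<open>w\<close> and being terminal depend on program counters alone, so it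
  does not matter that the swap may change the constraints.\<close>

lemma exec_trace_swap:
  assumes P: "concurrent_program P"
    and \<theta>: "derivation P s0 \<theta> s" and sched: "schedulable P s t"
    and tr: "exec_trace P s0 (\<theta> @ us @ [u, t] @ w)"
    and nd: "\<forall>v\<in>set us. \<not> can_deschedule P v t" "\<not> can_deschedule P t u"
  shows "exec_trace P s0 (\<theta> @ us @ [t, u] @ w)"
proof -
  obtain s3 where s3: "derivation P s0 (\<theta> @ us @ [u, t] @ w) s3" "terminal P s3"
    using tr unfolding exec_trace_def by blast
  \<comment> \<open>By determinism the prefix \<open>\<theta>\<close> of the trace ends in
    \<open>s\<close> itself.\<close>
  have "derivation P s (us @ [u, t] @ w) s3"
    using s3(1) derivation_deterministic[OF P \<theta>] unfolding derivation_append_iff[of P s0]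
    by blast
  then obtain s' where s': "derivation P s us s'" "derivation P s' (u # t # w) s3"
    unfolding derivation_append_iff[of P s us] by auto
  then obtain s1 s2 where d: "derivation P s us s'" "step P s' u s1" "step P s1 t s2"
      "derivation P s2 w s3" "terminal P s3"
    using s3(2) unfolding derivation_Cons_iff by blast
  have "schedulable P s' t" using schedulable_persists[OF d(1) sched nd(1)] .
  then obtain r1 r2 where r: "step P s' t r1" "step P r1 u r2" "pc r2 = pc s2"
    using step_swap[OF P d(2,3) _ nd(2)] by blast
  obtain r3 where r3: "derivation P r2 w r3" "pc r3 = pc s3"
    using derivation_pc_cong[OF d(4) r(3)[symmetric]] by blast
  have "derivation P s' ([t, u] @ w) r3"
    using derivation_Cons[OF r(1) derivation_Cons[OF r(2) r3(1)]] by simp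
  then have "derivation P s0 (\<theta> @ us @ [t, u] @ w) r3"
    using \<theta> d(1) derivation_append_iff by blast
  moreover have "terminal P r3"
    using d(5) by (simp add: terminal_cong[OF r3(2)])
  ultimately show ?thesis unfolding exec_trace_def by blast
qed

text \<open>\<open>t\<close> moves left one place at a time, first past the last element of
  \<open>us\<close>. Semi-commutativity after \<open>s\<close> admits arbitrary contexts
  \<open>w1\<close> and \<open>w2\<close>, so it covers each swap, and coverage is
  transitive.\<close>

lemma exec_trace_move_to_front:
  assumes P: "concurrent_program P"
    and \<theta>: "derivation P s0 \<theta> s" and sched: "schedulable P s t"
    and "exec_trace P s0 (\<theta> @ us @ t # w)"
    and "\<forall>u\<in>set us. semi_commutes_after P s0 \<psi> \<theta> s t u"
  shows "exec_trace P s0 (\<theta> @ t # us @ w) \<and> covers P s0 \<psi> (\<theta> @ t # us @ w) (\<theta> @ us @ t # w)"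
  using assms(4,5)
proof (induction us arbitrary: w rule: rev_induct)
  case (snoc u us)
  have sc: "semi_commutes_after P s0 \<psi> \<theta> s t u" using snoc.prems by simp
  have tr: "exec_trace P s0 (\<theta> @ us @ [u, t] @ w)" using snoc.prems by simp
  have tr': "exec_trace P s0 (\<theta> @ us @ [t, u] @ w)"
    using exec_trace_swap[OF P \<theta> sched tr] snoc.prems(2)
    by (auto simp: semi_commutes_after_def)
  have "set us \<subseteq> transitions P" "set w \<subseteq> transitions P"
    using tr derivation_in_transitions by (fastforce simp: exec_trace_def)+
  then have "covers P s0 \<psi> (\<theta> @ us @ [t, u] @ w) (\<theta> @ us @ [u, t] @ w)"
    using sc tr tr' by (auto simp: semi_commutes_after_def)
  \<comment> \<open>After the swap, \<open>u\<close> belongs to the suffix behind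
    \<open>t\<close>.\<close>
  moreover have "exec_trace P s0 (\<theta> @ t # us @ u # w) \<and>
      covers P s0 \<psi> (\<theta> @ t # us @ u # w) (\<theta> @ us @ t # u # w)"
    using snoc.IH[of "u # w"] snoc.prems tr' by simp
  ultimately show ?case by (auto simp: covers_def)
qed (auto simp: covers_def)

section \<open>Finished searches and the safety of explored prefixes\<close>

lemma explore_finished_satisfies: "explore P \<psi> PS \<theta> s Finished \<Longrightarrow> satisfies s \<psi>"
  by (simp add: explore.simps[of P \<psi> PS \<theta> s])

lemma explore_each_finished:
  assumes P: "concurrent_program P" and "explore_each P \<psi> PS \<theta> s ts Finished"
    and "t \<in> set ts" "enabled P s t" "step P s t s'"
  shows "explore P \<psi> PS (\<theta> @ [t]) s' Finished"
  using assms(2,3)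
proof (induction ts)
  case (Cons a ts)
  from Cons.prems(1) show ?case
  proof cases
    case each_disabled
    then show ?thesis using Cons assms(4) by auto
  next
    case (each_next s'')
    \<comment> \<open>If \<open>a = t\<close>, determinism identifies the explored successor
      \<open>s''\<close> with \<open>s'\<close>.\<close>
    then show ?thesis
      using Cons assms(5) by (auto dest: step_deterministic[OF P \<open>step P s a s''\<close>])
  qed
qed simp

lemma explore_finished_step:
  assumes P: "concurrent_program P" and "explore P \<psi> PS \<theta> s Finished"
    and "t \<in> PS \<theta> s" "enabled P s t" "step P s t s'"
  shows "explore P \<psi> PS (\<theta> @ [t]) s' Finished"
  using assms(2)
proof cases
  case (explore_loop ts)
  then show ?thesis using explore_each_finished[OF P] assms(3-5) by blast
qed

lemma search_reaches_derivation: "search_reaches P s0 \<psi> PS \<theta> s \<Longrightarrow> derivation P s0 \<theta> s"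
  by (induction rule: search_reaches.induct)
     (auto simp: derivation_Nil_iff derivation_append_iff derivation_Cons_iff)

lemma trace_safe_snoc:
  assumes "trace_safe P s0 \<psi> \<theta>" "\<And>s. derivation P s0 (\<theta> @ [t]) s \<Longrightarrow> satisfies s \<psi>"
  shows "trace_safe P s0 \<psi> (\<theta> @ [t])"
  unfolding trace_safe_def
proof (intro allI impI, elim conjE)
  fix \<eta> w s assume *: "\<theta> @ [t] = \<eta> @ w" "derivation P s0 \<eta> s"
  show "satisfies s \<psi>"
  proof (cases w rule: rev_cases)
    case Nil
    then show ?thesis using * assms(2) by simp
  next
    case (snoc w' x)
    then show ?thesis using * assms(1) by (auto simp: trace_safe_def)
  qed
qed

text \<open>Each earlier call on the path passed the test for \<open>\<psi>\<close>, as recorded in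
  \<open>search_succ\<close>; only the last state needs the hypothesis.\<close>

lemma search_reaches_trace_safe:
  assumes P: "concurrent_program P"
  shows "search_reaches P s0 \<psi> PS \<theta> s \<Longrightarrow> satisfies s \<psi> \<Longrightarrow> trace_safe P s0 \<psi> \<theta>"
proof (induction rule: search_reaches.induct)
  case search_init
  then show ?case by (auto simp: trace_safe_def derivation_Nil_iff)
next
  case (search_succ \<theta> s t s')
  have "derivation P s0 (\<theta> @ [t]) s'"
    using search_reaches_derivation[OF search_succ.hyps(1)] search_succ.hyps(5)
    by (auto simp: derivation_append_iff derivation_Cons_iff derivation_Nil_iff)
  then have "satisfies s'' \<psi>" if "derivation P s0 (\<theta> @ [t]) s''" for s''
    using search_succ.prems derivation_deterministic[OF P \<open>derivation P s0 (\<theta> @ [t]) s'\<close> that]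
    by simp
  then show ?case using trace_safe_snoc[OF search_succ.IH[OF search_succ.hyps(2)]] by simp
qed

text \<open>Executing \<open>t\<close> empties the constraint and no later step refills it. If
  \<open>t\<close> is not even schedulable, no derivation goes beyond
  \<open>\<theta>\<close>.\<close>

lemma trace_safe_disabled:
  assumes P: "concurrent_program P" and safe: "trace_safe P s0 \<psi> \<theta>"
    and \<theta>: "derivation P s0 \<theta> s" and dis: "\<not> enabled P s t"
  shows "trace_safe P s0 \<psi> (\<theta> @ t # w)"
proof (induction w rule: rev_induct)
  have sat: "satisfies s' \<psi>" if d: "derivation P s0 (\<theta> @ t # w) s'" for w s'
  proof -
    have "derivation P s (t # w) s'"
      using d derivation_deterministic[OF P \<theta>] unfolding derivation_append_iff by blast
    then obtain s1 where s1: "step P s t s1" "derivation P s1 w s'"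
      unfolding derivation_Cons_iff by blast
    have "constr s' = {}"
      using infeasible_derivation[OF s1(2) disabled_step_infeasible[OF s1(1) dis]] .
    then show ?thesis by (simp add: satisfies_def)
  qed
  {
    case Nil
    then show ?case using trace_safe_snoc[OF safe] sat[of "[]"] by simp
  next
    case (snoc a w)
    then show ?case using trace_safe_snoc[of P s0 \<psi> "\<theta> @ t # w" a] sat[of "w @ [a]"] by simp
  }
qed

section \<open>Traces and persistent sets\<close>

lemma persistent_transition_in_trace:
  assumes "persistent P s0 \<psi> \<theta> s T" "t \<in> T" "derivation P s w s'" "terminal P s'"
  shows "\<exists>u\<in>set w. u \<in> T"
proof (rule ccontr)
  assume "\<not> ?thesis"
  \<comment> \<open>If \<open>w\<close> avoids \<open>T\<close>, persistence applies to all of it,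
    and \<open>t\<close> stays schedulable up to the terminal state.\<close>
  then have "set w \<subseteq> transitions P - T" using derivation_in_transitions[OF assms(3)] by auto
  then have "\<forall>u\<in>set w. \<not> can_deschedule P u t"
    using assms(1-3) by (auto simp: persistent_def semi_commutes_after_def)
  moreover have "schedulable P s t" using assms(1,2) by (auto simp: persistent_def)
  ultimately have "schedulable P s' t" using schedulable_persists[OF assms(3)] by blast
  then show False using assms(4) by (auto simp: terminal_def)
qed

text \<open>The induction is on the length of \<open>w\<close> for all \<open>\<theta>\<close> and
  \<open>s\<close>, since a recursive call moves one transition from the suffix to the explored
  prefix.\<close>

lemma explored_trace_safe:
  assumes P: "concurrent_program P" and PS: "persistent_set_procedure P s0 \<psi> PS"
  shows "search_reaches P s0 \<psi> PS \<theta> s \<Longrightarrow> explore P \<psi> PS \<theta> s Finished \<Longrightarrow>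
    exec_trace P s0 (\<theta> @ w) \<Longrightarrow> trace_safe P s0 \<psi> (\<theta> @ w)"
proof (induction "length w" arbitrary: \<theta> s w rule: less_induct)
  case less
  note \<theta> = search_reaches_derivation[OF less.prems(1)]
  have sat: "satisfies s \<psi>" using explore_finished_satisfies[OF less.prems(2)] .
  have safe: "trace_safe P s0 \<psi> \<theta>" using search_reaches_trace_safe[OF P less.prems(1) sat] .
  obtain sf where sf: "derivation P s w sf" "terminal P sf"
    using less.prems(3) derivation_deterministic[OF P \<theta>]
    unfolding exec_trace_def derivation_append_iff by blast
  have pers: "persistent P s0 \<psi> \<theta> s (PS \<theta> s)"
    and ex: "\<exists>t. enabled P s t \<Longrightarrow> \<exists>t\<in>PS \<theta> s. enabled P s t"
    using PS less.prems(1) by (auto simp: persistent_set_procedure_def)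
  \<comment> \<open>Applied below with \<open>us @ v\<close>, the old suffix without
    \<open>t\<close>, in place of \<open>v\<close>.\<close>
  have first: "trace_safe P s0 \<psi> (\<theta> @ t # v)"
    if t: "t \<in> PS \<theta> s" and v: "length v < length w" "exec_trace P s0 (\<theta> @ t # v)" for t v
  proof (cases "enabled P s t")
    case True
    then obtain s' where s': "step P s t s'" using schedulable_step[of P s t] by (auto simp: enabled_def)
    have "search_reaches P s0 \<psi> PS (\<theta> @ [t]) s'"
      using search_succ[OF less.prems(1) sat t True s'] .
    moreover have "explore P \<psi> PS (\<theta> @ [t]) s' Finished"
      using explore_finished_step[OF P less.prems(2) t True s'] .
    ultimately show ?thesis using less.hyps[of v "\<theta> @ [t]" s'] v by simp
  next
    case False
    then show ?thesis using trace_safe_disabled[OF P safe \<theta>] by simp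
  qed
  show ?case
  proof (cases w)
    case Nil
    then show ?thesis using safe by simp
  next
    case (Cons a w')
    show ?thesis
    proof (cases "\<exists>t. enabled P s t")
      \<comment> \<open>The persistent set may be empty here, but the first transition
        \<open>a\<close> of the trace is disabled.\<close>
      case False
      then show ?thesis using trace_safe_disabled[OF P safe \<theta>] Cons by simp
    next
      case True
      \<comment> \<open>\<open>t'\<close> serves only to show that the trace meets the set; the
        first member \<open>t\<close> that it meets may be a different one, possibly
        disabled.\<close>
      then obtain t' where "t' \<in> PS \<theta> s" using ex by blast
      then obtain us t v where w: "w = us @ t # v" and t: "t \<in> PS \<theta> s"
        and us: "\<forall>u\<in>set us. u \<notin> PS \<theta> s"
        using split_list_first_prop[OF persistent_transition_in_trace[OF pers _ sf]] by metis
      obtain s' where s': "derivation P s us s'"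
        using sf(1) w by (auto simp: derivation_append_iff)
      have "set us \<subseteq> transitions P - PS \<theta> s"
        using us derivation_in_transitions[OF s'] by auto
      then have "\<forall>u\<in>set us. semi_commutes_after P s0 \<psi> \<theta> s t u"
        using pers s' t by (auto simp: persistent_def)
      moreover have "schedulable P s t" using pers t by (auto simp: persistent_def)
      ultimately have "exec_trace P s0 (\<theta> @ t # us @ v)"
        and cov: "covers P s0 \<psi> (\<theta> @ t # us @ v) (\<theta> @ us @ t # v)"
        using exec_trace_move_to_front[OF P \<theta>] less.prems(3) w by blast+
      then have "trace_safe P s0 \<psi> (\<theta> @ t # us @ v)" using first[OF t] w by simp
      then show ?thesis using cov w by (simp add: covers_def)
    qed
  qed
qed

section \<open>Extending derivations to traces by acyclicity\<close>

lemma card_trancl_less: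
  assumes "finite r" "acyclic r" "(a, b) \<in> r"
  shows "card (r\<^sup>+ `` {b}) < card (r\<^sup>+ `` {a})"
proof (rule psubset_card_mono)
  show "finite (r\<^sup>+ `` {a})" using assms(1) by (simp add: finite_Image)
  \<comment> \<open>\<open>b\<close> lies ahead of \<open>a\<close> but, without cycles, not ahead
    of itself, so the inclusion is strict.\<close>
  have "b \<in> r\<^sup>+ `` {a}" "b \<notin> r\<^sup>+ `` {b}"
    using assms(2,3) by (auto simp: acyclic_def)
  moreover have "r\<^sup>+ `` {b} \<subseteq> r\<^sup>+ `` {a}"
    using assms(3) by (auto intro: trancl_into_trancl2)
  ultimately show "r\<^sup>+ `` {b} \<subset> r\<^sup>+ `` {a}" by blast
qed

(* The number of locations still ahead, summed over the processes. *)
definition remaining ::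
    "('p::finite, 'l, 'g, 'v, 'd, 't) program \<Rightarrow> ('p, 'l, 'g, 'v, 'd) state \<Rightarrow> nat" where
  "remaining P s =
    (\<Sum>i\<in>UNIV. card ({(src P t, tgt P t) | t. t \<in> trans_of P i}\<^sup>+ `` {pc s i}))"

lemma remaining_decreases:
  assumes P: "concurrent_program P" and "step P s t s'"
  shows "remaining P s' < remaining P s"
proof -
  obtain i where i: "t \<in> trans_of P i" "pc s i = src P t" "pc s' = (pc s)(i := tgt P t)"
    using assms(2) by (auto simp: step_def)
  have fin: "finite {(src P t, tgt P t) | t. t \<in> trans_of P i}"
    and acyc: "acyclic {(src P t, tgt P t) | t. t \<in> trans_of P i}"
    using P by (auto simp: concurrent_program_def)
  have "(pc s i, pc s' i) \<in> {(src P t, tgt P t) | t. t \<in> trans_of P i}"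
    using i by auto
  \<comment> \<open>Only process \<open>i\<close> moves: its summand drops and the others are
    unchanged.\<close>
  from card_trancl_less[OF fin acyc this] show ?thesis
    unfolding remaining_def by (intro sum_strict_mono_ex1) (use i in auto)
qed

text \<open>A state that is not terminal always has a successor, since even a disabled schedulable
  transition can be executed, and \<open>remaining\<close> cannot decrease forever.\<close>

lemma derivation_to_terminal:
  assumes P: "concurrent_program P"
  shows "\<exists>w s'. derivation P s w s' \<and> terminal P s'"
proof (induction "remaining P s" arbitrary: s rule: less_induct)
  case less
  show ?case
  proof (cases "terminal P s")
    case True
    then show ?thesis using derivation_Nil[of P s] by blast
  next
    case False
    then obtain t s' where s': "step P s t s'"
      using schedulable_step[of P s] unfolding terminal_def by blast
    then obtain w s'' where "derivation P s' w s''" "terminal P s''"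
      using less[OF remaining_decreases[OF P s']] by blast
    then show ?thesis using derivation_Cons[OF s'] by blast
  qed
qed

theorem theorem1:
  fixes P :: "('p::finite, 'l, 'g, 'v, 'd, 't) program"
    and s0 :: "('p, 'l, 'g, 'v, 'd) state"
    and \<psi> :: "('p, 'l, 'g, 'v, 'd) form"
    and PS :: "'t list \<Rightarrow> ('p, 'l, 'g, 'v, 'd) state \<Rightarrow> 't set"
  assumes "concurrent_program P"
    and "persistent_set_procedure P s0 \<psi> PS"
    and "explore P \<psi> PS [] s0 Finished"
  shows "\<forall>s. reachable P s0 s \<longrightarrow> satisfies s \<psi>"
proof (intro allI impI)
  fix s assume "reachable P s0 s"
  then obtain \<theta> where \<theta>: "derivation P s0 \<theta> s" by (auto simp: reachable_def)
  obtain w s' where "derivation P s w s'" "terminal P s'"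
    using derivation_to_terminal[OF assms(1)] by blast
  \<comment> \<open>\<open>s\<close> lies on this trace, being reached by its prefix
    \<open>\<theta>\<close>; the empty list is the derivation of the initial call.\<close>
  then have "exec_trace P s0 ([] @ \<theta> @ w)"
    using \<theta> by (auto simp: exec_trace_def derivation_append_iff)
  then have "trace_safe P s0 \<psi> ([] @ \<theta> @ w)"
    using explored_trace_safe[OF assms(1,2) search_init assms(3)] by blast
  then show "satisfies s \<psi>" using \<theta> by (auto simp: trace_safe_def)
qed

end
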